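(* Let $\gamma$ be a screw parabolic isometry of $\mathbb{H}^4$ with fixed point $v$ and twisting plane $P$. Then a plane $Q\subset\mathbb{H}^4$ is orthogonal to $P$ through a line (of $P\cap Q$) having $v$ as an endpoint at infinity if and only if $\partial Q\in\mathcal{K}_\gamma$.
   Context: Identify $\partial\mathbb{H}^4$ with $\widehat{\mathbb{R}^3}$. A screw parabolic isometry $\gamma$ is conjugate, by a Möbius map $\phi$ sending its fixed point $v$ to $\infty$, to the Poincaré extension of $x\mapsto Ax+b$ with $A\in\mathrm{SO}(3)$ nontrivial, $Ab=b$, $b\ne0$. Its rotational part is the conjugate of $x\mapsto Ax$, a type-I elliptic isometry whose fixed plane is the twisting plane $P$ of $\gamma$; $\partial P$ corresponds to the line $\mathbb{R}b\cup\{\infty\}$. The permuted pencil $\mathcal{F}_\gamma$ is the image under $\phi^{-1}$ of the set of Euclidean planes orthogonal to $b$ (with $\infty$ added). The twisting pencil $\mathcal{R}_\gamma$ is the set of boundaries of hyperplanes containing $P$. The half-turn bank is $\mathcal{K}_\gamma=\{s\cap t: s\in\mathcal{F}_\gamma,\ t\in\mathcal{R}_\gamma\}$. *)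

theory Defs
  imports "HOL-Analysis.Analysis"
begin

text \<open>Upper half-space model of hyperbolic 4-space:
  H^4 = R^3 x (0,inf).  Its ideal boundary R^3 u {inf} is identified with
  the set  {Some (x,0)} u {None}  inside the one-point compactification
  (real^3 x real) option of R^4 (None = the point at infinity).\<close>

type_synonym pt = "((real^3) \<times> real) option"

definition H4 :: "((real^3) \<times> real) set" where
  "H4 = {p. snd p > 0}"

text \<open>Totally geodesic k-planes of H^4 (k = 1 lines, 2 planes, 3 hyperplanes):
  vertical ones over an affine (k-1)-flat of R^3, and hemispherical ones
  (k-sphere centred on the boundary, inside a vertical affine (k+1)-flat).\<close>

definition hplane :: "nat \<Rightarrow> ((real^3) \<times> real) set \<Rightarrow> bool" where
  "hplane k Q \<longleftrightarrow>
     (\<exists>L. affine L \<and> aff_dim L = int k - 1 \<and> Q = {(x,t). t > 0 \<and> x \<in> L}) \<or>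
     (\<exists>L a r. affine L \<and> aff_dim L = int k \<and> a \<in> L \<and> r > 0 \<and>
        Q = {(x,t). t > 0 \<and> x \<in> L \<and> (dist x a)\<^sup>2 + t\<^sup>2 = r\<^sup>2})"

text \<open>Boundary at infinity of a subset of H^4 (its closure in the compactification,
  intersected with the ideal boundary).\<close>

definition ideal_bd :: "((real^3) \<times> real) set \<Rightarrow> pt set" where
  "ideal_bd X = (\<lambda>x. Some (x, 0)) ` {x. (x, 0) \<in> closure X}
                \<union> (if bounded X then {} else {None})"

definition hyp_metric :: "(real^3) \<times> real \<Rightarrow> (real^3) \<times> real \<Rightarrow> (real^3) \<times> real \<Rightarrow> real" where
  "hyp_metric p u w = inner u w / (snd p)\<^sup>2"

definition tangent_space :: "((real^3) \<times> real) set \<Rightarrow> (real^3) \<times> real \<Rightarrow> ((real^3) \<times> real) set" where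
  "tangent_space S p = {u. \<exists>c :: real \<Rightarrow> (real^3) \<times> real. c 0 = p \<and>
      eventually (\<lambda>s. c s \<in> S) (nhds 0) \<and> (c has_vector_derivative u) (at 0)}"

definition orth_along ::
  "((real^3) \<times> real) set \<Rightarrow> ((real^3) \<times> real) set \<Rightarrow> ((real^3) \<times> real) set \<Rightarrow> bool" where
  "orth_along P Q l \<longleftrightarrow>
     (\<forall>p\<in>l. \<forall>u\<in>tangent_space P p. \<forall>w\<in>tangent_space Q p.
        (\<forall>d\<in>tangent_space l p. hyp_metric p u d = 0) \<and>
        (\<forall>d\<in>tangent_space l p. hyp_metric p w d = 0) \<longrightarrow> hyp_metric p u w = 0)"

definition orth_through_line_at :: "((real^3) \<times> real) set \<Rightarrow> ((real^3) \<times> real) set \<Rightarrow> pt \<Rightarrow> bool" where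
  "orth_through_line_at P Q v \<longleftrightarrow>
     (\<exists>l. hplane 1 l \<and> P \<inter> Q = l \<and> v \<in> ideal_bd l \<and> orth_along P Q l)"

text \<open>Moebius transformations of the compactified R^4 generated by reflections in
  spheres / hyperplanes orthogonal to the boundary R^3 x {0}.  These are exactly the
  Poincare extensions of the Moebius transformations of R^3 u {inf}, i.e. (acting on
  H^4) the isometries of H^4, and (acting on the boundary) the Moebius maps.\<close>

definition sph_inv :: "real^3 \<Rightarrow> real \<Rightarrow> pt \<Rightarrow> pt" where
  "sph_inv a r q = (case q of None \<Rightarrow> Some (a, 0)
     | Some p \<Rightarrow> if p = (a, 0) then None
                 else Some ((a, 0) + (r\<^sup>2 / (norm (p - (a, 0)))\<^sup>2) *\<^sub>R (p - (a, 0))))"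

definition pl_refl :: "real^3 \<Rightarrow> real \<Rightarrow> pt \<Rightarrow> pt" where
  "pl_refl n c q = (case q of None \<Rightarrow> None
     | Some (x, t) \<Rightarrow> Some (x - (2 * (inner x n - c) / (norm n)\<^sup>2) *\<^sub>R n, t))"

inductive mobius :: "(pt \<Rightarrow> pt) \<Rightarrow> bool" where
  mob_id: "mobius id"
| mob_sph: "mobius f \<Longrightarrow> r > 0 \<Longrightarrow> mobius (sph_inv a r \<circ> f)"
| mob_pl: "mobius f \<Longrightarrow> n \<noteq> 0 \<Longrightarrow> mobius (pl_refl n c \<circ> f)"

definition affext :: "real^3^3 \<Rightarrow> real^3 \<Rightarrow> pt \<Rightarrow> pt" where
  "affext A b q = (case q of None \<Rightarrow> None | Some (x, t) \<Rightarrow> Some (A *v x + b, t))"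

text \<open>Data attached to a screw parabolic isometry conjugated by phi to affext A b.\<close>

definition twisting_plane :: "(pt \<Rightarrow> pt) \<Rightarrow> real^3^3 \<Rightarrow> ((real^3) \<times> real) set" where
  "twisting_plane \<phi> A = {p \<in> H4. (inv \<phi> \<circ> affext A 0 \<circ> \<phi>) (Some p) = Some p}"

definition permuted_pencil :: "(pt \<Rightarrow> pt) \<Rightarrow> real^3 \<Rightarrow> pt set set" where
  "permuted_pencil \<phi> b =
     {inv \<phi> ` ((\<lambda>x. Some (x, 0)) ` {x. inner x b = c} \<union> {None}) | c. True}"

definition twisting_pencil :: "((real^3) \<times> real) set \<Rightarrow> pt set set" where
  "twisting_pencil P = {ideal_bd S | S. hplane 3 S \<and> P \<subseteq> S}"

definition half_turn_bank :: "(pt \<Rightarrow> pt) \<Rightarrow> real^3^3 \<Rightarrow> real^3 \<Rightarrow> pt set set" where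
  "half_turn_bank \<phi> A b =
     {s \<inter> t | s t. s \<in> permuted_pencil \<phi> b \<and> t \<in> twisting_pencil (twisting_plane \<phi> A)}"

end

theory Submission
  imports Defs
begin

text \<open>
  Generators of the Moebius group scale distances by a product of two point weights, so a Moebius
  map fixing \<open>\<infinity>\<close> is a similarity \<open>(x, t) \<mapsto> (m x, k t)\<close>. Hence \<open>\<phi>\<close> is a similarity, possibly preceded by the
  inversion at \<open>v\<close>. The similarity only replaces the line \<open>\<real> b\<close> by another line \<open>\<ell>\<close>. If \<open>v = \<infinity>\<close>, all the
  planes involved are vertical and the claim says that two lines of Euclidean space meet
  orthogonally iff the second is cut out by a plane orthogonal to \<open>\<ell>\<close> and a plane containing \<open>\<ell>\<close>.
  If \<open>v\<close> is finite, either side of the claim forces every plane involved to have \<open>v\<close> at infinity, so that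
  inversion at \<open>v\<close>, which is conformal, reduces the claim to the first case.
\<close>

section \<open>Moebius maps that fix infinity\<close>

text \<open>Both squares expand into the same rational expression in inner products. This is the
  distance formula for inversion in the unit sphere, the source of the weights of
  inversions.\<close>

lemma norm_inversion_diff:
  fixes u v :: "'a::real_inner"
  assumes "u \<noteq> 0" "v \<noteq> 0"
  shows "norm ((1 / (norm u)\<^sup>2) *\<^sub>R u - (1 / (norm v)\<^sup>2) *\<^sub>R v) = norm (u - v) / (norm u * norm v)"
proof (rule power2_eq_imp_eq)
  have "(norm ((1 / (norm u)\<^sup>2) *\<^sub>R u - (1 / (norm v)\<^sup>2) *\<^sub>R v))\<^sup>2
      = 1 / (u \<bullet> u) - 2 * (u \<bullet> v) / ((u \<bullet> u) * (v \<bullet> v)) + 1 / (v \<bullet> v)"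
    using assms by (simp add: power2_norm_eq_inner inner_diff_left inner_diff_right inner_commute
        divide_simps)
  also have "\<dots> = (norm (u - v) / (norm u * norm v))\<^sup>2"
    using assms by (simp add: power_divide power_mult_distrib power2_norm_eq_inner inner_diff_left
        inner_diff_right inner_commute divide_simps)
  finally show "(norm ((1 / (norm u)\<^sup>2) *\<^sub>R u - (1 / (norm v)\<^sup>2) *\<^sub>R v))\<^sup>2
      = (norm (u - v) / (norm u * norm v))\<^sup>2" .
qed auto

text \<open>With these values at \<open>None\<close>, the weights of an inversion are positive at every point, so that
  \<open>pdist (f p) (f q) = w p * w q * pdist p q\<close> passes to compositions.\<close>

definition pdist :: "pt \<Rightarrow> pt \<Rightarrow> real" where
  "pdist p q = (case p of None \<Rightarrow> (case q of None \<Rightarrow> 0 | Some y \<Rightarrow> 1)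
     | Some x \<Rightarrow> (case q of None \<Rightarrow> 1 | Some y \<Rightarrow> dist x y))"

lemma pdist_simps [simp]:
  "pdist None None = 0" "pdist None (Some y) = 1" "pdist (Some x) None = 1"
  "pdist (Some x) (Some y) = dist x y"
  by (simp_all add: pdist_def)

text \<open>The offset \<open>c\<close> cancels in the difference of two images, which leaves the
  linear reflection of the difference; that reflection preserves norms, and heights do not
  change.\<close>

lemma pdist_pl_refl:
  assumes "n \<noteq> 0"
  shows "pdist (pl_refl n c p) (pl_refl n c q) = pdist p q"
proof (cases p; cases q)
  fix x y assume pq: "p = Some x" "q = Some y"
  define z where "z = fst x - fst y"
  have e: "fst x - (2 * (fst x \<bullet> n - c) / (norm n)\<^sup>2) *\<^sub>R n
      - (fst y - (2 * (fst y \<bullet> n - c) / (norm n)\<^sup>2) *\<^sub>R n) = z - (2 * (z \<bullet> n) / (n \<bullet> n)) *\<^sub>R n"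
    by (simp add: z_def power2_norm_eq_inner inner_diff_left algebra_simps diff_divide_distrib)
  have "(z - (2 * (z \<bullet> n) / (n \<bullet> n)) *\<^sub>R n) \<bullet> (z - (2 * (z \<bullet> n) / (n \<bullet> n)) *\<^sub>R n) = z \<bullet> z"
    using assms by (simp add: inner_diff_left inner_diff_right inner_commute divide_simps)
  then have "norm (z - (2 * (z \<bullet> n) / (n \<bullet> n)) *\<^sub>R n) = norm z"
    by (simp add: norm_eq_sqrt_inner)
  then have "dist (fst x - (2 * (fst x \<bullet> n - c) / (norm n)\<^sup>2) *\<^sub>R n)
      (fst y - (2 * (fst y \<bullet> n - c) / (norm n)\<^sup>2) *\<^sub>R n) = dist (fst x) (fst y)"
    by (simp only: dist_norm e) (simp add: z_def)
  then show ?thesis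
    by (simp add: pq pl_refl_def dist_prod_def split_beta)
qed (auto simp: pl_refl_def)

lemma pl_refl_pl_refl:
  assumes "n \<noteq> 0"
  shows "pl_refl n c (pl_refl n c p) = p"
proof (cases p)
  case (Some q)
  define k where "k = 2 * (fst q \<bullet> n - c) / (norm n)\<^sup>2"
  have "2 * ((fst q - k *\<^sub>R n) \<bullet> n - c) / (norm n)\<^sup>2 = - k"
    using assms by (simp add: k_def inner_diff_left power2_norm_eq_inner field_simps)
  moreover have "pl_refl n c p = Some (fst q - k *\<^sub>R n, snd q)"
    by (simp add: Some pl_refl_def split_beta k_def)
  ultimately show ?thesis
    by (simp add: Some pl_refl_def)
qed (simp add: pl_refl_def)

lemma sph_inv_sph_inv:
  assumes "r > 0"
  shows "sph_inv a r (sph_inv a r p) = p"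
proof (cases "p = None \<or> p = Some (a, 0)")
  case False
  then obtain q where q: "p = Some q" "q \<noteq> (a,0)" by auto
  define u where "u = q - (a,0)"
  have u: "u \<noteq> 0" "q = (a,0) + u" using q by (auto simp: u_def)
  have "(r\<^sup>2 / (norm ((r\<^sup>2 / (norm u)\<^sup>2) *\<^sub>R u))\<^sup>2) *\<^sub>R (r\<^sup>2 / (norm u)\<^sup>2) *\<^sub>R u = u"
    using u assms by (simp add: power_divide power_mult_distrib power2_eq_square)
  then show ?thesis using q(1) u assms by (simp add: sph_inv_def)
qed (auto simp: sph_inv_def)

lemma pdist_sph_inv:
  assumes "r > 0"
  shows "\<exists>w. (\<forall>p. w p > 0) \<and> (\<forall>p q. pdist (sph_inv a r p) (sph_inv a r q) = w p * w q * pdist p q)"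
proof -
  define c where "c = (a, 0::real)"
  define J where "J x = c + (r\<^sup>2 / (norm (x - c))\<^sup>2) *\<^sub>R (x - c)" for x
  have S: "sph_inv a r q = (case q of None \<Rightarrow> Some c
      | Some p \<Rightarrow> if p = c then None else Some (J p))" for q
    unfolding sph_inv_def c_def J_def ..
  \<comment> \<open>The value \<open>r / dist x c\<close> is read off the distance formula; pairs
    containing \<open>None\<close> or the centre then force the other two values.\<close>
  define w where "w p = (case p of None \<Rightarrow> r | Some x \<Rightarrow> if x = c then 1 / r else r / dist x c)"
    for p :: pt
  have "w p > 0" for p using assms by (simp add: w_def split: option.splits)
  moreover have "pdist (sph_inv a r p) (sph_inv a r q) = w p * w q * pdist p q" for p q
  proof -
    have *: "dist (J x) (J y)
        = r\<^sup>2 * dist x y / (dist x c * dist y c)" if "x \<noteq> c" "y \<noteq> c" for x y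
    proof -
      have "(r\<^sup>2 / (norm (x - c))\<^sup>2) *\<^sub>R (x - c) - (r\<^sup>2 / (norm (y - c))\<^sup>2) *\<^sub>R (y - c)
          = r\<^sup>2 *\<^sub>R ((1 / (norm (x - c))\<^sup>2) *\<^sub>R (x - c) - (1 / (norm (y - c))\<^sup>2) *\<^sub>R (y - c))"
        by (simp add: scaleR_diff_right)
      then show ?thesis
        using norm_inversion_diff[of "x - c" "y - c"] that by (simp add: J_def dist_norm)
    qed
    have **: "dist (J x) c = r\<^sup>2 / dist x c" for x
      by (simp add: J_def dist_norm power2_eq_square)
    have ***: "dist c (J x) = r\<^sup>2 / dist x c" for x
      using **[of x] by (simp only: dist_commute)
    show ?thesis
      using assms
      by (cases p; cases q)
        (auto simp: S w_def * ** *** dist_commute[of c] power2_eq_square)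
  qed
  ultimately show ?thesis by blast
qed

text \<open>Weights compose: that of \<open>g \<circ> f\<close> at \<open>p\<close> is the weight of
  \<open>g\<close> at \<open>f p\<close> times the weight of \<open>f\<close> at \<open>p\<close>.
  Reflections leave the weight as it is.\<close>

lemma mobius_pdist:
  assumes "mobius f"
  shows "\<exists>w. (\<forall>p. w p > 0) \<and> (\<forall>p q. pdist (f p) (f q) = w p * w q * pdist p q)"
  using assms
proof induction
  case mob_id
  show ?case by (rule exI[of _ "\<lambda>_. 1"]) simp
next
  case (mob_sph f r a)
  then obtain w where w: "\<forall>p. w p > 0" "\<forall>p q. pdist (f p) (f q) = w p * w q * pdist p q" by blast
  obtain w' where w': "\<forall>p. w' p > 0"
    "\<forall>p q. pdist (sph_inv a r p) (sph_inv a r q) = w' p * w' q * pdist p q"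
    using pdist_sph_inv mob_sph by metis
  show ?case
    by (rule exI[of _ "\<lambda>p. w' (f p) * w p"]) (simp add: w w')
next
  case (mob_pl f n c)
  then show ?case by (simp add: pdist_pl_refl)
qed

lemma mobius_bij: "mobius f \<Longrightarrow> bij f"
proof (induction rule: mobius.induct)
  case (mob_sph f r a)
  have "bij (sph_inv a r)"
    using sph_inv_sph_inv[OF mob_sph(2)] by (intro o_bij[where g = "sph_inv a r"]) auto
  then show ?case using mob_sph by (intro bij_comp)
next
  case (mob_pl f n c)
  have "bij (pl_refl n c)"
    using pl_refl_pl_refl[OF mob_pl(2)] by (intro o_bij[where g = "pl_refl n c"]) auto
  then show ?case using mob_pl by (intro bij_comp)
qed (rule bij_id)

text \<open>The inductive rules add generators after \<open>f\<close>, while the normalization of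
  \<open>\<phi>\<close> puts an inversion before it.\<close>

lemma mobius_comp_sph_inv:
  assumes "mobius f" "r > 0"
  shows "mobius (f \<circ> sph_inv a r)"
  using assms(1)
proof induction
  case mob_id
  show ?case using mobius.mob_sph[OF mobius.mob_id assms(2)] by simp
next
  case (mob_sph f r' a')
  then show ?case using mobius.mob_sph by (metis comp_assoc)
next
  case (mob_pl f n c)
  then show ?case using mobius.mob_pl by (metis comp_assoc)
qed

text \<open>Reflection in the ideal boundary. It commutes with all generators, since their spheres
  and planes are orthogonal to the boundary, and it fixes exactly the ideal points.\<close>

definition pt_flip :: "pt \<Rightarrow> pt" where
  "pt_flip = map_option (\<lambda>p. (fst p, - snd p))"

lemma mobius_flip: "mobius f \<Longrightarrow> f (pt_flip q) = pt_flip (f q)"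
proof (induction arbitrary: q rule: mobius.induct)
  case (mob_sph f r a)
  have "sph_inv a r (pt_flip p) = pt_flip (sph_inv a r p)" for p
    by (cases p) (auto simp: pt_flip_def sph_inv_def norm_prod_def prod_eq_iff)
  then show ?case using mob_sph by simp
next
  case (mob_pl f n c)
  have "pl_refl n c (pt_flip p) = pt_flip (pl_refl n c p)" for p
    by (cases p) (auto simp: pt_flip_def pl_refl_def)
  then show ?case using mob_pl by simp
qed (simp add: pt_flip_def)

lemma mobius_H4: "mobius f \<Longrightarrow> p \<in> H4 \<Longrightarrow> \<exists>p'\<in>H4. f (Some p) = Some p'"
proof (induction rule: mobius.induct)
  case (mob_sph f r a)
  then obtain p' where "p' \<in> H4" "f (Some p) = Some p'" by blast
  with mob_sph show ?case
    by (cases p') (auto simp: sph_inv_def H4_def zero_prod_def intro!: divide_pos_pos mult_pos_pos)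
next
  case (mob_pl f n c)
  then obtain p' where "p' \<in> H4" "f (Some p) = Some p'" by blast
  then show ?case by (cases p') (auto simp: pl_refl_def H4_def)
qed simp

text \<open>\<open>None\<close> is fixed by \<open>pt_flip\<close>; by commutation and injectivity
  so is its preimage, which is therefore ideal.\<close>

lemma mobius_to_None:
  assumes "mobius f" "f v = None"
  shows "v = None \<or> (\<exists>c. v = Some (c, 0))"
proof -
  have "f (pt_flip v) = f v" using assms mobius_flip[OF assms(1)] by (simp add: pt_flip_def)
  then have "pt_flip v = v" using mobius_bij[OF assms(1)] by (simp add: bij_def inj_eq)
  then show ?thesis by (cases v) (auto simp: pt_flip_def prod_eq_iff)
qed

text \<open>Comparison with \<open>None\<close> makes the weight constant on finite points, so
  \<open>f\<close> is a Euclidean similarity there. Commuting with \<open>pt_flip\<close> and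
  preserving \<open>H4\<close> fixes the heights, and Pythagoras gives the horizontal part.\<close>

lemma mobius_fixing_None:
  assumes f: "mobius f" and N: "f None = None"
  obtains m :: "real^3 \<Rightarrow> real^3" and k where "k > 0"
    "\<And>x y. dist (m x) (m y) = k * dist x y" "\<And>x t. f (Some (x,t)) = Some (m x, k * t)"
proof -
  obtain w where w: "\<forall>p. w p > 0" "\<forall>p q. pdist (f p) (f q) = w p * w q * pdist p q"
    using mobius_pdist[OF f] by blast
  define k where "k = 1 / (w None)\<^sup>2"
  have inj: "inj f" using mobius_bij[OF f] bij_is_inj by blast
  have "\<exists>y. f (Some p) = Some y" for p
    using inj N by (metis injD not_Some_eq option.distinct(1))
  then obtain s where s: "\<And>p. f (Some p) = Some (s p)" by metis
  have wp: "w (Some p) = 1 / w None" for p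
  proof -
    have "1 = w (Some p) * w None" using w(2)[rule_format, of "Some p" None] by (simp add: N s)
    then show ?thesis using w(1) by (metis less_numeral_extra(3) nonzero_eq_divide_eq)
  qed
  have d: "dist (s p) (s q) = k * dist p q" for p q
    using w(2)[rule_format, of "Some p" "Some q"] by (simp add: s wp k_def power2_eq_square)
  have k: "k > 0" using w(1)[rule_format, of None] by (simp add: k_def)
  have fl: "s (x, -t) = (fst (s (x,t)), - snd (s (x,t)))" for x t
    using mobius_flip[OF f, of "Some (x,t)"] by (simp add: s pt_flip_def)
  \<comment> \<open>The mirror points \<open>(x,t)\<close> and \<open>(x,-t)\<close> have mirror
    images, and their distance is scaled by \<open>k\<close>.\<close>
  have ab: "\<bar>snd (s (x,t))\<bar> = k * \<bar>t\<bar>" for x t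
  proof -
    have "dist (s (x,t)) (s (x,-t)) = 2 * \<bar>snd (s (x,t))\<bar>"
      by (subst fl) (simp add: dist_prod_def dist_norm real_sqrt_mult)
    then show ?thesis unfolding d by (simp add: dist_prod_def dist_norm real_sqrt_mult)
  qed
  have pos: "snd (s (x,t)) = k * t" if "t > 0" for x t
    using mobius_H4[OF f, of "(x,t)"] ab[of x t] that by (auto simp: H4_def s)
  have sn: "snd (s (x,t)) = k * t" for x t
    using pos[of t x] pos[of "-t" x] fl[of x t] ab[of x t]
    by (cases "t > 0"; cases "t < 0") auto
  \<comment> \<open>The vertical part of the distance is known, so subtracting it isolates the
    horizontal part, which is thereby scaled by \<open>k\<close> and does not depend on
    heights.\<close>
  have dd: "(dist (s p) (s q))\<^sup>2 = (dist (fst (s p)) (fst (s q)))\<^sup>2 + k\<^sup>2 * (dist (snd p) (snd q))\<^sup>2" for p q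
    using sn[of "fst p" "snd p"] sn[of "fst q" "snd q"]
    by (simp add: dist_prod_def dist_norm power_mult_distrib flip: right_diff_distrib)
  have fs: "dist (fst (s p)) (fst (s q)) = k * dist (fst p) (fst q)" for p q
  proof (rule power2_eq_imp_eq)
    show "(dist (fst (s p)) (fst (s q)))\<^sup>2 = (k * dist (fst p) (fst q))\<^sup>2"
      using dd[of p q] unfolding d by (simp add: dist_prod_def power_mult_distrib algebra_simps)
  qed (use k in auto)
  define m where "m x = fst (s (x,0))" for x
  have "fst (s (x,t)) = m x" for x t
    using fs[of "(x,t)" "(x,0)"] by (simp add: m_def)
  then have "f (Some (x,t)) = Some (m x, k * t)" for x t
    by (simp add: s prod_eq_iff sn)
  moreover have "dist (m x) (m y) = k * dist x y" for x y
    using fs[of "(x,0)" "(y,0)"] by (simp add: m_def)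
  ultimately show ?thesis using that k by blast
qed

section \<open>Planes with infinity as an ideal point\<close>

text \<open>If a fixed vector had a nonzero component \<open>y\<close> orthogonal to
  \<open>b\<close>, then \<open>cross3 b y\<close> would also be fixed, because \<open>A\<close>
  preserves orientation. Three orthogonal fixed vectors span the space and make \<open>A\<close> the
  identity.\<close>

lemma rotation_fixed_line:
  fixes A :: "real^3^3"
  assumes A: "orthogonal_matrix A" "det A = 1" "A \<noteq> mat 1" and b: "A *v b = b" "b \<noteq> 0"
  shows "A *v x = x \<longleftrightarrow> (\<exists>s. x = s *\<^sub>R b)"
proof
  assume x: "A *v x = x"
  define y where "y = x - (x \<bullet> b / (b \<bullet> b)) *\<^sub>R b"
  have y: "A *v y = y" "b \<bullet> y = 0"
    using x b by (simp_all add: y_def matrix_vector_mult_diff_distrib matrix_vector_mult_scaleR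
        inner_diff_right inner_commute)
  have "y = 0"
  proof (rule ccontr)
    assume "y \<noteq> 0"
    define z where "z = cross3 b y"
    have z: "A *v z = z" "b \<bullet> z = 0" "y \<bullet> z = 0"
      using cross_orthogonal_matrix[OF A(1), of b y] A(2) b y by (simp_all add: z_def dot_cross_self)
    have "z \<noteq> 0"
      using norm_and_cross_eq_0[of b y] b(2) \<open>y \<noteq> 0\<close> y(2) by (auto simp: z_def)
    have ne: "b \<noteq> y" "b \<noteq> z" "y \<noteq> z" using y z b(2) \<open>y \<noteq> 0\<close> by auto
    have "pairwise orthogonal {b,y,z}"
      using y z by (auto simp: pairwise_def orthogonal_def inner_commute)
    then have "independent {b,y,z}"
      using pairwise_orthogonal_independent b(2) \<open>y \<noteq> 0\<close> \<open>z \<noteq> 0\<close> by blast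
    moreover have "card {b,y,z} = 3" using ne by simp
    ultimately have "dim {b,y,z} = DIM(real^3)" using dim_eq_card_independent by fastforce
    then have "span {b,y,z} = UNIV" using dim_eq_full by blast
    moreover have "span {b,y,z} \<subseteq> {x. A *v x = x}"
      using y z b by (intro span_minimal)
        (auto simp: subspace_def matrix_vector_right_distrib matrix_vector_mult_scaleR)
    ultimately have "\<forall>x. A *v x = mat 1 *v x" by auto
    then show False using A(3) matrix_eq by blast
  qed
  then show "\<exists>s. x = s *\<^sub>R b" by (auto simp: y_def)
qed (auto simp: matrix_vector_mult_scaleR b)

section \<open>Vertical and hemispherical planes, their ideal points and tangent vectors\<close>

definition vert :: "(real^3) set \<Rightarrow> ((real^3) \<times> real) set" where
  "vert L = {(x,t). t > 0 \<and> x \<in> L}"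

definition hemi :: "(real^3) set \<Rightarrow> real^3 \<Rightarrow> real \<Rightarrow> ((real^3) \<times> real) set" where
  "hemi L a r = {(x,t). t > 0 \<and> x \<in> L \<and> (dist x a)\<^sup>2 + t\<^sup>2 = r\<^sup>2}"

lemma hplane_iff:
  "hplane k Q \<longleftrightarrow> (\<exists>L. affine L \<and> aff_dim L = int k - 1 \<and> Q = vert L) \<or>
     (\<exists>L a r. affine L \<and> aff_dim L = int k \<and> a \<in> L \<and> r > 0 \<and> Q = hemi L a r)"
  by (simp add: hplane_def vert_def hemi_def)

lemma hplane_vert: "affine L \<Longrightarrow> aff_dim L = int k - 1 \<Longrightarrow> hplane k (vert L)"
  unfolding hplane_iff by blast

lemma vert_subset_H4: "vert L \<subseteq> H4"
  by (auto simp: vert_def H4_def)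

lemma hplane_hemi: "affine L \<Longrightarrow> aff_dim L = int k \<Longrightarrow> a \<in> L \<Longrightarrow> r > 0 \<Longrightarrow> hplane k (hemi L a r)"
  unfolding hplane_iff by blast

lemma hplane_subset_H4: "hplane k Q \<Longrightarrow> Q \<subseteq> H4"
  by (auto simp: hplane_def H4_def)

lemma bounded_hemi: "bounded (hemi L a r)"
proof (rule boundedI)
  fix p assume "p \<in> hemi L a r"
  then have "dist p (a, 0) = \<bar>r\<bar>" by (auto simp: hemi_def dist_prod_def)
  moreover have "norm p \<le> norm (a, 0::real) + dist p (a, 0)"
    unfolding dist_norm by (rule norm_triangle_sub)
  ultimately show "norm p \<le> norm (a, 0::real) + \<bar>r\<bar>" by simp
qed

text \<open>Hemispheres are bounded. Since \<open>ideal_bd\<close> contains \<open>None\<close>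
  exactly for unbounded sets, the planes with infinity as an ideal point are the vertical
  ones.\<close>

lemma hplane_unbounded:
  assumes "hplane k Q" "\<not> bounded Q"
  obtains L where "affine L" "aff_dim L = int k - 1" "Q = vert L"
  using assms bounded_hemi unfolding hplane_iff by blast

lemma in_closure_vert:
  assumes "x \<in> L"
  shows "(x, 0) \<in> closure (vert L)"
  unfolding closure_approachable
proof (intro allI impI)
  fix e :: real assume "e > 0"
  then have "(x, e/2) \<in> vert L" "dist (x, e/2) (x, 0) < e"
    using assms by (auto simp: vert_def dist_prod_def)
  then show "\<exists>y\<in>vert L. dist y (x, 0) < e" by blast
qed

lemma closure_vert_subset:
  assumes "affine L"
  shows "closure (vert L) \<subseteq> L \<times> UNIV"
  using closed_Times[OF affine_closed[OF assms] closed_UNIV]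
  by (intro closure_minimal) (auto simp: vert_def)

text \<open>The right-hand side is closed. At height 0 it says that a finite ideal point of a
  hemisphere lies in \<open>L\<close> at distance \<open>r\<close> from \<open>a\<close>.\<close>

lemma closure_hemi_subset:
  assumes "affine L"
  shows "closure (hemi L a r) \<subseteq> {p. fst p \<in> L \<and> (dist (fst p) a)\<^sup>2 + (snd p)\<^sup>2 = r\<^sup>2}"
proof (rule closure_minimal)
  have "closed (fst -` L \<inter> {p. (dist (fst p) a)\<^sup>2 + (snd p)\<^sup>2 = r\<^sup>2})"
    using assms
    by (intro closed_Int closed_vimage affine_closed closed_Collect_eq continuous_intros)
  then show "closed {p. fst p \<in> L \<and> (dist (fst p) a)\<^sup>2 + (snd p)\<^sup>2 = r\<^sup>2}"
    by (simp add: vimage_def Collect_conj_eq)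
qed (auto simp: hemi_def)

lemma bounded_vert_iff: "bounded (vert L) \<longleftrightarrow> L = {}"
proof
  assume b: "bounded (vert L)"
  show "L = {}"
  proof (rule ccontr)
    assume "L \<noteq> {}"
    then obtain x where "x \<in> L" by blast
    obtain M where M: "\<And>p. p \<in> vert L \<Longrightarrow> norm p \<le> M" using b bounded_iff by blast
    show False using norm_snd_le[of "\<bar>M\<bar> + 1" x] M[of "(x, \<bar>M\<bar> + 1)"] \<open>x \<in> L\<close>
      by (simp add: vert_def) linarith
  qed
qed (simp add: vert_def)

lemma ideal_bd_vert:
  assumes "affine L" "L \<noteq> {}"
  shows "ideal_bd (vert L) = (\<lambda>x. Some (x, 0)) ` L \<union> {None}"
proof -
  have "{x. (x, 0) \<in> closure (vert L)} = L"
    using in_closure_vert closure_vert_subset[OF assms(1)] by fastforce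
  then show ?thesis using assms(2) by (simp add: ideal_bd_def bounded_vert_iff)
qed

lemma None_in_ideal_bd [simp]: "None \<in> ideal_bd X \<longleftrightarrow> \<not> bounded X"
  by (auto simp: ideal_bd_def)

lemma Some_in_ideal_bd [simp]: "Some (x, 0) \<in> ideal_bd X \<longleftrightarrow> (x, 0) \<in> closure X"
  by (auto simp: ideal_bd_def)

lemma ideal_bd_mono: "X \<subseteq> Y \<Longrightarrow> ideal_bd X \<subseteq> ideal_bd Y"
  using closure_mono[of X Y] bounded_subset[of Y X] by (auto simp: ideal_bd_def)

lemma vert_subset_iff: "vert L \<subseteq> vert M \<longleftrightarrow> L \<subseteq> M"
  by (auto simp: vert_def subset_iff) (metis zero_less_one)

lemma vert_Int: "vert L \<inter> vert M = vert (L \<inter> M)"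
  by (auto simp: vert_def)

lemma vert_eq_iff: "vert L = vert M \<longleftrightarrow> L = M"
  by (metis vert_subset_iff subset_antisym order_refl)

text \<open>A linear functional that is constant on \<open>L\<close> has derivative 0 along every
  curve in \<open>vert L\<close>. Suitable choices of \<open>n\<close> bound tangent spaces from
  above.\<close>

lemma fst_tangent_vert:
  assumes "u \<in> tangent_space (vert L) p" and const: "\<And>x. x \<in> L \<Longrightarrow> x \<bullet> n = k"
  shows "fst u \<bullet> n = 0"
proof -
  obtain c where c: "eventually (\<lambda>s. c s \<in> vert L) (nhds 0)" "(c has_vector_derivative u) (at 0)"
    using assms(1) unfolding tangent_space_def by blast
  have "((\<lambda>s. fst (c s) \<bullet> n) has_vector_derivative fst u \<bullet> n) (at 0)"
    using bounded_linear.has_vector_derivative[OF bounded_linear_compose[OF bounded_linear_inner_left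
      bounded_linear_fst] c(2)] by simp
  moreover have ev: "eventually (\<lambda>s. fst (c s) \<bullet> n = k) (nhds 0)"
    using c(1) by eventually_elim (auto simp: vert_def const)
  have "((\<lambda>s. fst (c s) \<bullet> n) has_vector_derivative 0) (at 0)"
    unfolding has_vector_derivative_def
    by (rule has_derivative_transform_eventually[of "\<lambda>_. k"])
      (use ev eventually_nhds_x_imp_x[OF ev] in \<open>auto simp: eventually_at_filter elim: eventually_mono\<close>)
  ultimately show ?thesis by (metis vector_derivative_at)
qed

text \<open>A straight curve serves as witness: its height stays positive near 0, and membership is
  required only there.\<close>

lemma tangent_vertI:
  assumes "\<And>s. x + s *\<^sub>R g \<in> L" "t > 0"
  shows "(g, h) \<in> tangent_space (vert L) (x, t)"
proof -
  have "((\<lambda>s. (x, t) + s *\<^sub>R (g, h)) has_vector_derivative (g, h)) (at 0)"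
    by (auto intro!: derivative_eq_intros simp: has_vector_derivative_def)
  moreover have "eventually (\<lambda>s. t + s * h > 0) (nhds (0::real))"
  proof (rule order_tendstoD)
    show "((\<lambda>s. t + s * h) \<longlongrightarrow> t + 0 * h) (nhds 0)" by (intro tendsto_intros filterlim_ident)
  qed (use assms in simp)
  then have "eventually (\<lambda>s. (x, t) + s *\<^sub>R (g, h) \<in> vert L) (nhds (0::real))"
    by eventually_elim (use assms in \<open>auto simp: vert_def\<close>)
  ultimately show ?thesis unfolding tangent_space_def
    by (intro CollectI exI[of _ "\<lambda>s. (x, t) + s *\<^sub>R (g, h)"]) simp
qed

section \<open>The claim when the fixed point is infinity\<close>

abbreviation line_through :: "real^3 \<Rightarrow> real^3 \<Rightarrow> (real^3) set" where
  "line_through q e \<equiv> range (\<lambda>s. q + s *\<^sub>R e)"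

abbreviation bd_plane :: "real^3 \<Rightarrow> real \<Rightarrow> pt set" where
  "bd_plane e k \<equiv> (\<lambda>x. Some (x, 0)) ` {x. x \<bullet> e = k} \<union> {None}"

text \<open>The component \<open>n\<close> of \<open>fst u\<close> orthogonal to \<open>e\<close> is
  a functional constant on the line, so \<open>fst u \<bullet> n = 0\<close>; this number is also
  \<open>n \<bullet> n\<close>.\<close>

lemma fst_tangent_line_through:
  assumes "u \<in> tangent_space (vert (line_through q e)) p" "e \<noteq> 0"
  shows "fst u = (fst u \<bullet> e / (e \<bullet> e)) *\<^sub>R e"
proof -
  define n where "n = fst u - (fst u \<bullet> e / (e \<bullet> e)) *\<^sub>R e"
  have n: "n \<bullet> e = 0" using assms(2) by (simp add: n_def inner_diff_left)
  have "fst u \<bullet> n = 0"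
    by (rule fst_tangent_vert[OF assms(1), of n "q \<bullet> n"])
      (use n in \<open>auto simp: inner_add_left inner_add_right inner_commute\<close>)
  then have "n \<bullet> n = 0"
    by (subst (1) n_def) (use n in \<open>simp add: inner_diff_left inner_diff_right inner_commute\<close>)
  then show ?thesis by (simp add: n_def)
qed

text \<open>\<open>Q\<close> stands over a Euclidean line \<open>L\<close> that meets the axis in
  one point \<open>y\<close>. Orthogonality forces \<open>L\<close> to be perpendicular to
  \<open>e\<close>, so \<open>L\<close> is cut out of the plane spanned by \<open>L\<close> and the
  axis by the plane through \<open>y\<close> orthogonal to \<open>e\<close>.\<close>

lemma orth_through_line_at_infinity_imp_pencils:
  assumes e: "e \<noteq> 0" and Q: "hplane 2 Q"
    and orth: "orth_through_line_at (vert (line_through q e)) Q None"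
  shows "\<exists>k S. hplane 3 S \<and> vert (line_through q e) \<subseteq> S \<and> ideal_bd Q = bd_plane e k \<inter> ideal_bd S"
proof -
  let ?P = "vert (line_through q e)"
  obtain l where l: "hplane 1 l" "?P \<inter> Q = l" "\<not> bounded l" "orth_along ?P Q l"
    using orth unfolding orth_through_line_at_def by auto
  obtain Y where "aff_dim Y = 0" "l = vert Y" using hplane_unbounded[OF l(1,3)] by auto
  then obtain y where y: "l = vert {y}" by (auto simp: aff_dim_eq_0)
  have "\<not> bounded Q" using l bounded_subset by blast
  then obtain L where L: "affine L" "aff_dim L = 1" "Q = vert L"
    using hplane_unbounded[OF Q] by auto
  have "line_through q e \<inter> L = {y}" using l(2) by (simp add: L(3) vert_Int y vert_eq_iff)
  then have yL: "y \<in> L" and "y \<in> line_through q e" by auto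
  then obtain s0 where s0: "y = q + s0 *\<^sub>R e" by auto
  have in_line: "y + s *\<^sub>R e \<in> line_through q e" for s
    by (rule range_eqI[of _ _ "s0 + s"]) (simp add: s0 algebra_simps)
  \<comment> \<open>Orthogonality is tested at height 1 with horizontal vectors, which are normal to
    the vertical line \<open>l\<close>.\<close>
  have perp: "x \<bullet> e = y \<bullet> e" if "x \<in> L" for x
  proof -
    have "(y, 1) \<in> l" by (simp add: y vert_def)
    moreover have "(e, 0) \<in> tangent_space ?P (y, 1)" by (rule tangent_vertI[OF in_line]) simp
    moreover have "(x - y, 0) \<in> tangent_space Q (y, 1)"
    proof -
      have "y + s *\<^sub>R (x - y) \<in> L" for s
        using mem_affine[OF L(1) yL that, of "1 - s" s] by (simp add: algebra_simps)
      then show ?thesis unfolding L(3) by (intro tangent_vertI) auto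
    qed
    moreover have "fst d \<bullet> n = 0" if "d \<in> tangent_space l (y, 1)" for d n
      using fst_tangent_vert[of d "{y}" "(y,1)" n "y \<bullet> n"] that by (simp add: y)
    then have "\<forall>d\<in>tangent_space l (y,1). hyp_metric (y,1) (u, 0) d = 0" for u
      by (auto simp: hyp_metric_def inner_prod_def inner_commute)
    ultimately have "hyp_metric (y, 1) (e, 0) (x - y, 0) = 0"
      using l(4) unfolding orth_along_def by blast
    then show ?thesis by (simp add: hyp_metric_def inner_diff_right inner_commute)
  qed
  \<comment> \<open>The Euclidean plane spanned by \<open>L\<close> and the axis; the vertical
    hyperplane over it gives the member of the twisting pencil.\<close>
  define M where "M = affine hull (insert (y + e) L)"
  let ?H = "{x. e \<bullet> x = y \<bullet> e}"
  have yeM: "y + e \<in> M" "L \<subseteq> M" "affine M"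
    unfolding M_def using hull_subset[of "insert (y + e) L" affine] by (auto intro: affine_affine_hull)
  have "y + e \<notin> ?H" using e by (simp add: inner_add_left inner_add_right inner_commute)
  moreover have LH: "L \<subseteq> ?H" using perp by (auto simp: inner_commute)
  ultimately have "y + e \<notin> L" by blast
  then have dM: "aff_dim M = 2"
    using L by (simp add: M_def aff_dim_affine_hull aff_dim_insert hull_same)
  have "line_through q e \<subseteq> M"
  proof
    fix z assume "z \<in> line_through q e"
    then obtain s where "z = q + s *\<^sub>R e" by auto
    then have "z = (1 - (s - s0)) *\<^sub>R y + (s - s0) *\<^sub>R (y + e)" by (simp add: s0 algebra_simps)
    then show "z \<in> M" using mem_affine[of M y "y + e"] yeM yL by auto
  qed
  then have "?P \<subseteq> vert M" by (simp add: vert_subset_iff)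
  moreover have "hplane 3 (vert M)" using hplane_vert yeM dM by auto
  \<comment> \<open>\<open>L\<close> lies in the intersection, and both have dimension 1:
    \<open>y + e\<close> is in \<open>M\<close> but off the hyperplane, so the dimension drops by
    one.\<close>
  moreover have "L = M \<inter> ?H"
  proof (rule affine_dim_equal)
    show "affine (M \<inter> ?H)" using yeM by (intro affine_Int affine_hyperplane)
    show "aff_dim L = aff_dim (M \<inter> ?H)"
      unfolding aff_dim_affine_Int_hyperplane[OF yeM(3)]
      using yeM yL LH L dM \<open>y + e \<notin> ?H\<close> by auto
  qed (use L yL yeM LH in auto)
  then have "ideal_bd Q = bd_plane e (y \<bullet> e) \<inter> ideal_bd (vert M)"
    using L yL yeM by (subst L(3), subst (1 2) ideal_bd_vert) (auto simp: inner_commute)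
  ultimately show ?thesis by blast
qed

text \<open>\<open>S\<close> contains an unbounded set, so \<open>None\<close> is an ideal point of
  \<open>S\<close> and hence of \<open>Q\<close>. Both are vertical, and the boundary equation
  becomes one between their Euclidean bases. Tangent vectors of \<open>Q\<close> are then orthogonal
  to \<open>e\<close>, while those of the twisting plane normal to \<open>l\<close> are multiples of
  it.\<close>

lemma pencils_imp_orth_through_line_at_infinity:
  assumes e: "e \<noteq> 0" and Q: "hplane 2 Q"
    and S: "hplane 3 S" "vert (line_through q e) \<subseteq> S"
    and bd: "ideal_bd Q = bd_plane e k \<inter> ideal_bd S"
  shows "orth_through_line_at (vert (line_through q e)) Q None"
proof -
  let ?P = "vert (line_through q e)"
  have "\<not> bounded S"
    using S(2) bounded_subset bounded_vert_iff[of "line_through q e"] by blast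
  then obtain M where M: "affine M" "aff_dim M = 2" "S = vert M"
    using hplane_unbounded[OF S(1)] by auto
  have lM: "line_through q e \<subseteq> M" using S(2) by (simp add: M(3) vert_subset_iff)
  then have "M \<noteq> {}" by auto
  have "None \<in> ideal_bd Q" using \<open>\<not> bounded S\<close> by (simp add: bd)
  then have "\<not> bounded Q" by simp
  then obtain L where L: "affine L" "aff_dim L = 1" "Q = vert L"
    using hplane_unbounded[OF Q] by auto
  have "L \<noteq> {}" using L(2) by auto
  have "x \<in> L \<longleftrightarrow> x \<bullet> e = k \<and> x \<in> M" for x
  proof -
    have "Some (x, 0) \<in> ideal_bd Q \<longleftrightarrow> Some (x, 0) \<in> bd_plane e k \<inter> ideal_bd S" by (simp only: bd)
    then show ?thesis
      unfolding L(3) M(3) ideal_bd_vert[OF L(1) \<open>L \<noteq> {}\<close>] ideal_bd_vert[OF M(1) \<open>M \<noteq> {}\<close>] by auto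
  qed
  then have Leq: "L = {x. x \<bullet> e = k} \<inter> M" by auto
  \<comment> \<open>The point of the axis at level \<open>k\<close>: the coefficient solves
    \<open>(q + s *\<^sub>R e) \<bullet> e = k\<close> for \<open>s\<close>.\<close>
  define y where "y = q + ((k - q \<bullet> e) / (e \<bullet> e)) *\<^sub>R e"
  have ye: "y \<bullet> e = k" using e by (simp add: y_def inner_add_left)
  have "line_through q e \<inter> L = {y}"
  proof
    show "line_through q e \<inter> L \<subseteq> {y}"
    proof
      fix z assume z: "z \<in> line_through q e \<inter> L"
      then obtain s where s: "z = q + s *\<^sub>R e" by auto
      have "z \<bullet> e = k" using z Leq by auto
      then have "s = (k - q \<bullet> e) / (e \<bullet> e)" using e by (simp add: s inner_add_left field_simps)
      then show "z \<in> {y}" by (simp add: s y_def)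
    qed
    have "y \<in> line_through q e" by (auto simp: y_def)
    then show "{y} \<subseteq> line_through q e \<inter> L" using lM Leq ye by auto
  qed
  then have PQ: "?P \<inter> Q = vert {y}" by (simp add: L(3) vert_Int)
  have "orth_along ?P Q (vert {y})"
    unfolding orth_along_def
  proof (intro ballI impI)
    fix p u w
    assume p: "p \<in> vert {y}" and u: "u \<in> tangent_space ?P p" and w: "w \<in> tangent_space Q p"
      and orth: "(\<forall>d\<in>tangent_space (vert {y}) p. hyp_metric p u d = 0) \<and>
        (\<forall>d\<in>tangent_space (vert {y}) p. hyp_metric p w d = 0)"
    have p': "p = (y, snd p)" "snd p > 0" using p by (auto simp: vert_def)
    \<comment> \<open>The vertical direction is tangent to the common line, so a vector normal to
      that line is horizontal.\<close>
    have "(0, 1) \<in> tangent_space (vert {y}) p"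
      by (subst p'(1), rule tangent_vertI) (use p' in auto)
    then have "hyp_metric p u (0, 1) = 0" using orth by blast
    then have "snd u = 0" using p' by (simp add: hyp_metric_def inner_prod_def)
    moreover have "fst w \<bullet> e = 0"
      using w unfolding L(3) by (rule fst_tangent_vert) (auto simp: Leq)
    then have "fst u \<bullet> fst w = 0"
      by (subst fst_tangent_line_through[OF u e]) (simp add: inner_commute)
    ultimately show "hyp_metric p u w = 0" by (simp add: hyp_metric_def inner_prod_def)
  qed
  moreover have "hplane 1 (vert {y})" by (rule hplane_vert) auto
  ultimately show ?thesis
    unfolding orth_through_line_at_def using PQ by (auto simp: bounded_vert_iff)
qed

section \<open>Inversion at a finite ideal point\<close>

text \<open>Inversion in the unit sphere about \<open>c\<close>, over any inner product space so
  that it serves both for the boundary and for the half-space. The centre is sent to itself, which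
  makes the map an involution of the whole space; \<open>sph_inv\<close> instead exchanges centre
  and infinity.\<close>

definition inv_at :: "'a::real_inner \<Rightarrow> 'a \<Rightarrow> 'a" where
  "inv_at c p = c + (1 / (norm (p - c))\<^sup>2) *\<^sub>R (p - c)"

lemma inv_at_diff: "inv_at c p - c = (1 / (norm (p - c))\<^sup>2) *\<^sub>R (p - c)"
  by (simp add: inv_at_def)

lemma norm_inv_at_diff: "norm (inv_at c p - c) = 1 / norm (p - c)"
  by (simp add: inv_at_diff power2_eq_square divide_simps)

lemma inv_at_eq_center_iff [simp]: "inv_at c p = c \<longleftrightarrow> p = c"
  by (simp add: inv_at_def)

lemma inv_at_inv_at [simp]: "inv_at c (inv_at c p) = p"
proof -
  have "inv_at c (inv_at c p) - c = p - c"
    by (simp add: inv_at_diff[of c "inv_at c p"] norm_inv_at_diff inv_at_diff power2_eq_square)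
  then show ?thesis by simp
qed

lemma image_inv_at_inv_at [simp]: "inv_at c ` inv_at c ` X = X"
  by (simp add: image_image)

lemma sph_inv_one:
  "sph_inv c 1 None = Some (c, 0)" "sph_inv c 1 (Some (c, 0)) = None"
  "p \<noteq> (c, 0) \<Longrightarrow> sph_inv c 1 (Some p) = Some (inv_at (c, 0) p)"
  by (auto simp: sph_inv_def inv_at_def)

lemma image_sph_inv_sph_inv: "r > 0 \<Longrightarrow> sph_inv a r ` sph_inv a r ` X = X"
  by (simp add: image_image sph_inv_sph_inv)

lemma inj_sph_inv: "r > 0 \<Longrightarrow> inj (sph_inv a r)"
  by (metis injI sph_inv_sph_inv)

lemma vimage_sph_inv: "r > 0 \<Longrightarrow> sph_inv a r -` X = sph_inv a r ` X"
  by (auto simp: sph_inv_sph_inv intro: rev_image_eqI)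

lemma inv_at_boundary: "inv_at (c, 0::real) (x, 0) = (inv_at c x, 0)"
  by (simp add: inv_at_def norm_Pair)

lemma snd_inv_at: "snd (inv_at (c, 0::real) p) = snd p / (norm (p - (c, 0)))\<^sup>2"
  by (simp add: inv_at_def)

lemma H4_not_boundary: "p \<in> H4 \<Longrightarrow> p \<noteq> (c, 0)"
  by (auto simp: H4_def)

lemma inv_at_H4: "p \<in> H4 \<Longrightarrow> inv_at (c, 0) p \<in> H4"
  using H4_not_boundary[of p c] by (simp add: H4_def snd_inv_at del: add_Pair)

lemma inv_at_image_eq: "inv_at c ` X = {p. inv_at c p \<in> X}"
  by (auto simp: image_iff) (metis inv_at_inv_at)

lemma inj_inv_at: "inj (inv_at c)"
  by (metis injI inv_at_inv_at)

lemma isCont_inv_at: "p \<noteq> c \<Longrightarrow> isCont (inv_at c) p"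
  unfolding inv_at_def by (intro continuous_intros) auto

text \<open>Distances to the centre become reciprocals, so points running to infinity approach the
  centre and conversely; other ideal points are handled by continuity. This proves one inclusion,
  and applying it to the inverted set gives the other.\<close>

lemma ideal_bd_inv_at:
  assumes "X \<subseteq> H4"
  shows "ideal_bd (inv_at (c, 0) ` X) = sph_inv c 1 ` ideal_bd X"
proof -
  let ?o = "(c, 0::real)"
  have *: "sph_inv c 1 ` ideal_bd X \<subseteq> ideal_bd (inv_at ?o ` X)" if X: "X \<subseteq> H4" for X
  proof
    fix q assume "q \<in> sph_inv c 1 ` ideal_bd X"
    then obtain v where v: "v \<in> ideal_bd X" "q = sph_inv c 1 v" by blast
    then consider (inf) "v = None" | (centre) "v = Some ?o" | (other) x where "v = Some (x, 0)" "x \<noteq> c"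
      unfolding ideal_bd_def by (auto split: if_splits)
    then show "q \<in> ideal_bd (inv_at ?o ` X)"
    proof cases
      case inf
      have unb: "\<not> bounded X" using v inf by simp
      have "?o \<in> closure (inv_at ?o ` X)"
        unfolding closure_approachable
      proof (intro allI impI)
        fix e :: real assume "e > 0"
        obtain p where p: "p \<in> X" "dist ?o p > 1 / e"
          using unb unfolding bounded_any_center[of X ?o] by (meson not_le_imp_less)
        have "0 < 1 / e" using \<open>e > 0\<close> by simp
        then have "0 < dist ?o p" using p(2) by (rule less_trans)
        moreover have "dist (inv_at ?o p) ?o = 1 / dist ?o p"
          by (metis dist_commute dist_norm norm_inv_at_diff)
        moreover have "1 / dist ?o p < e" if "dist ?o p > 0"
          using p(2) that \<open>e > 0\<close> by (simp add: field_simps)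
        ultimately have "dist (inv_at ?o p) ?o < e" by simp
        then show "\<exists>y\<in>inv_at ?o ` X. dist y ?o < e" using p by blast
      qed
      then show ?thesis by (simp add: v inf sph_inv_one)
    next
      case centre
      have cl: "?o \<in> closure X" using v centre by simp
      have "\<not> bounded (inv_at ?o ` X)"
      proof
        assume "bounded (inv_at ?o ` X)"
        then obtain R where R: "\<And>p. p \<in> X \<Longrightarrow> dist ?o (inv_at ?o p) \<le> R"
          unfolding bounded_any_center[of _ ?o] by blast
        obtain p where p: "p \<in> X" "dist p ?o < 1 / (\<bar>R\<bar> + 1)"
          using cl unfolding closure_approachable
          by (meson abs_ge_zero add_nonneg_pos divide_pos_pos zero_less_one)
        have "p \<noteq> ?o" using p(1) X H4_not_boundary by blast
        then have "1 / norm (p - ?o) > \<bar>R\<bar> + 1"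
          using p(2) by (simp add: dist_norm field_simps)
        moreover have "dist ?o (inv_at ?o p) = 1 / norm (p - ?o)"
          by (metis dist_commute dist_norm norm_inv_at_diff)
        ultimately show False using R[OF p(1)] by linarith
      qed
      then show ?thesis by (simp add: v centre sph_inv_one)
    next
      case other
      have "(x, 0) \<in> closure X" using v other by simp
      then obtain s where s: "\<And>n. s n \<in> X" "s \<longlonglongrightarrow> (x, 0)" unfolding closure_sequential by blast
      have "(\<lambda>n. inv_at ?o (s n)) \<longlonglongrightarrow> inv_at ?o (x, 0)"
        by (rule isCont_tendsto_compose[OF isCont_inv_at s(2)]) (use other in auto)
      then have "inv_at ?o (x, 0) \<in> closure (inv_at ?o ` X)"
        unfolding closure_sequential using s(1) by (intro exI[of _ "\<lambda>n. inv_at ?o (s n)"]) auto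
      then show ?thesis using other by (simp add: v sph_inv_one inv_at_boundary)
    qed
  qed
  have "inv_at ?o ` X \<subseteq> H4" using assms inv_at_H4 by blast
  then have "sph_inv c 1 ` sph_inv c 1 ` ideal_bd (inv_at ?o ` X) \<subseteq> sph_inv c 1 ` ideal_bd X"
    using *[of "inv_at ?o ` X"] by (intro image_mono) simp
  then show ?thesis using *[OF assms] by (simp add: image_sph_inv_sph_inv)
qed

section \<open>Images of hyperbolic planes under inversion\<close>

lemma affine_scale_from:
  assumes "affine L" "c \<in> L" "s \<noteq> 0"
  shows "c + s *\<^sub>R (x - c) \<in> L \<longleftrightarrow> x \<in> L"
proof -
  have *: "c + s *\<^sub>R (x - c) \<in> L" if "x \<in> L" for x s
    using mem_affine[OF assms(1,2) that, of "1 - s" s] by (simp add: algebra_simps)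
  show ?thesis using *[of x s] *[of "c + s *\<^sub>R (x - c)" "1 / s"] assms(3) by auto
qed

lemma fst_inv_at: "fst (inv_at (c, 0::real) p) = c + (1 / (norm (p - (c, 0)))\<^sup>2) *\<^sub>R (fst p - c)"
  by (simp add: inv_at_def)

text \<open>Inversion scales the horizontal coordinate from \<open>c\<close> by a nonzero factor,
  which preserves an affine set through \<open>c\<close>.\<close>

lemma inv_at_image_vert:
  assumes "affine L" "c \<in> L"
  shows "inv_at (c, 0) ` vert L = vert L"
proof -
  have "inv_at (c, 0) p \<in> vert L \<longleftrightarrow> p \<in> vert L" for p
  proof (cases "p \<in> H4")
    case True
    have "norm (p - (c, 0)) \<noteq> 0" using H4_not_boundary[OF True] by simp
    then show ?thesis
      using True inv_at_H4[OF True, of c] affine_scale_from[OF assms, of "1 / (norm (p - (c, 0)))\<^sup>2" "fst p"]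
      by (simp add: vert_def H4_def split_beta fst_inv_at)
  next
    case False
    then have "inv_at (c, 0) p \<notin> H4" by (metis inv_at_H4 inv_at_inv_at)
    with False show ?thesis by (auto simp: vert_def H4_def)
  qed
  then show ?thesis by (simp add: inv_at_image_eq)
qed

text \<open>With \<open>N\<close> the squared distance from \<open>p\<close> to the centre, a point
  lies on this sphere through the centre iff \<open>2 * ((a - c) \<bullet> (fst p - c)) = N\<close>.
  Dividing by \<open>2 * N\<close> turns this into the equation of a hyperplane for the
  image.\<close>

lemma inv_at_image_hemi:
  assumes "affine L" "c \<in> L" "dist c a = r"
  shows "inv_at (c, 0) ` hemi L a r = vert (L \<inter> {x. (a - c) \<bullet> x = 1 / 2 + (a - c) \<bullet> c})"
proof -
  have "inv_at (c, 0) p \<in> vert (L \<inter> {x. (a - c) \<bullet> x = 1 / 2 + (a - c) \<bullet> c}) \<longleftrightarrow> p \<in> hemi L a r" for p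
  proof (cases "p \<in> H4")
    case True
    define N where "N = (norm (p - (c, 0)))\<^sup>2"
    have N: "N > 0" using H4_not_boundary[OF True] by (simp add: N_def)
    have N': "N = (fst p - c) \<bullet> (fst p - c) + (snd p)\<^sup>2"
      by (simp add: N_def norm_prod_def power2_norm_eq_inner)
    have r: "r\<^sup>2 = (a - c) \<bullet> (a - c)"
      using assms(3) by (simp add: dist_norm norm_minus_commute power2_norm_eq_inner flip: assms(3))
    have "(a - c) \<bullet> fst (inv_at (c, 0) p) = (a - c) \<bullet> c + ((a - c) \<bullet> (fst p - c)) / N"
      by (simp only: fst_inv_at inner_add_right N_def inner_scaleR_right) simp
    then have "(a - c) \<bullet> fst (inv_at (c, 0) p) = 1 / 2 + (a - c) \<bullet> c
        \<longleftrightarrow> ((a - c) \<bullet> (fst p - c)) / N = 1 / 2" by linarith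
    also have "\<dots> \<longleftrightarrow> 2 * ((a - c) \<bullet> (fst p - c)) = N"
      using N by (simp only: divide_eq_eq) auto
    also have "\<dots> \<longleftrightarrow> (dist (fst p) a)\<^sup>2 + (snd p)\<^sup>2 = r\<^sup>2"
      unfolding N' r by (simp add: dist_norm power2_norm_eq_inner inner_diff_left inner_diff_right
          inner_commute algebra_simps) auto
    finally show ?thesis
      using True N inv_at_H4[OF True, of c] affine_scale_from[OF assms(1,2), of "1 / N" "fst p"]
      by (simp add: vert_def hemi_def H4_def split_beta fst_inv_at N_def)
  next
    case False
    then have "inv_at (c, 0) p \<notin> H4" by (metis inv_at_H4 inv_at_inv_at)
    with False show ?thesis by (auto simp: vert_def hemi_def H4_def)
  qed
  then show ?thesis unfolding inv_at_image_eq[of "(c, 0)" "hemi L a r"]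
    by (metis (no_types, lifting) Collect_cong Collect_mem_eq inv_at_inv_at)
qed

text \<open>An ideal point \<open>c\<close> lies in the base of a vertical plane or on the sphere of
  a hemispherical one. In both cases the image is vertical.\<close>

lemma hplane_inv_at:
  assumes X: "hplane k X" and c: "(c, 0) \<in> closure X"
  shows "hplane k (inv_at (c, 0) ` X)"
  using X[unfolded hplane_iff]
proof (elim disjE exE conjE)
  fix L assume L: "affine L" "aff_dim L = int k - 1" "X = vert L"
  then have "c \<in> L" using c closure_vert_subset[OF L(1)] by auto
  then show ?thesis using L X inv_at_image_vert by simp
next
  fix L a r assume L: "affine L" "aff_dim L = int k" "a \<in> L" "r > 0" "X = hemi L a r"
  have cL: "c \<in> L" and "(dist c a)\<^sup>2 = r\<^sup>2" using c closure_hemi_subset[OF L(1), of a r] L(5) by auto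
  then have d: "dist c a = r" using L(4) by simp
  let ?H = "{x. (a - c) \<bullet> x = 1 / 2 + (a - c) \<bullet> c}"
  have ac: "a \<noteq> c" using d L(4) by auto
  \<comment> \<open>The foot of the perpendicular from \<open>c\<close> shows that the intersection
    is nonempty; \<open>c\<close> itself is off the hyperplane, so the dimension drops by exactly
    one.\<close>
  have "c + (1 / (2 * ((a - c) \<bullet> (a - c)))) *\<^sub>R (a - c) \<in> L \<inter> ?H"
    using affine_scale_from[OF L(1) cL, of "1 / (2 * ((a - c) \<bullet> (a - c)))" a] L(3) ac
    by (simp add: inner_add_right)
  moreover have "c \<notin> ?H" by simp
  ultimately have "aff_dim (L \<inter> ?H) = int k - 1"
    unfolding aff_dim_affine_Int_hyperplane[OF L(1)] using cL L(2) by auto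
  moreover have "affine (L \<inter> ?H)" using L(1) by (intro affine_Int affine_hyperplane)
  ultimately show ?thesis
    unfolding L(5) inv_at_image_hemi[OF L(1) cL d] using hplane_vert by blast
qed

text \<open>For \<open>c\<close> outside \<open>L\<close>, the image is a hemisphere whose sphere
  passes through \<open>c\<close>. It is found by realizing \<open>L\<close> as the flat that
  \<open>inv_at_image_hemi\<close> produces.\<close>

lemma hplane_inv_at_unbounded:
  assumes X: "hplane k X" and unb: "\<not> bounded X"
  shows "hplane k (inv_at (c, 0) ` X)"
proof -
  obtain L where L: "affine L" "aff_dim L = int k - 1" "X = vert L"
    using hplane_unbounded[OF X unb] .
  have "L \<noteq> {}" using unb by (simp add: L(3) bounded_vert_iff)
  show ?thesis
  proof (cases "c \<in> L")
    case True
    then show ?thesis using L X inv_at_image_vert by simp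
  next
    case False
    have cl: "closed L" "convex L" using L(1) by (simp_all add: affine_closed affine_imp_convex)
    define y where "y = closest_point L c"
    have y: "y \<in> L" "\<forall>z\<in>L. dist c y \<le> dist c z"
      using closest_point_exists[OF cl(1) \<open>L \<noteq> {}\<close>, of c] by (auto simp: y_def)
    define g where "g = y - c"
    have "g \<noteq> 0" using y(1) False by (auto simp: g_def)
    \<comment> \<open>The inequality for the closest point \<open>y\<close> holds for
      \<open>x\<close> and for its reflection in \<open>y\<close>, so it is an equality.\<close>
    have perp: "g \<bullet> (x - y) = 0" if "x \<in> L" for x
    proof -
      have "y + (-1) *\<^sub>R (x - y) \<in> L"
        using affine_scale_from[OF L(1) y(1), of "-1" x] that by simp
      then have "(c - y) \<bullet> (x - y) \<le> 0" "(c - y) \<bullet> ((y + (-1) *\<^sub>R (x - y)) - y) \<le> 0"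
        using any_closest_point_dot[OF cl(2,1) y(1) _ y(2)] that by blast+
      then show ?thesis by (simp add: g_def inner_diff_left inner_diff_right)
    qed
    \<comment> \<open>The inverse of the foot \<open>y\<close> is diametrically opposite to
      \<open>c\<close> on the sphere sought, so the centre is the midpoint of these two
      points.\<close>
    define a where "a = c + (1 / (2 * (g \<bullet> g))) *\<^sub>R g"
    define M where "M = affine hull (insert c L)"
    let ?H = "{x. (a - c) \<bullet> x = 1 / 2 + (a - c) \<bullet> c}"
    have M: "affine M" "c \<in> M" "L \<subseteq> M"
      unfolding M_def using hull_subset[of "insert c L" affine] by auto
    have dM: "aff_dim M = int k"
      using False L by (simp add: M_def aff_dim_affine_hull aff_dim_insert hull_same)
    have LH: "L \<subseteq> ?H"
    proof
      fix x assume "x \<in> L"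
      then have "g \<bullet> x = g \<bullet> y" using perp[of x] by (simp add: inner_diff_right)
      then have "g \<bullet> x - g \<bullet> c = g \<bullet> g" by (simp add: g_def inner_diff_right)
      then show "x \<in> ?H" using \<open>g \<noteq> 0\<close> by (simp add: a_def field_simps)
    qed
    have "L = M \<inter> ?H"
    proof (rule affine_dim_equal)
      show "affine (M \<inter> ?H)" using M by (intro affine_Int affine_hyperplane)
      have "c \<notin> ?H" by simp
      then show "aff_dim L = aff_dim (M \<inter> ?H)"
        unfolding aff_dim_affine_Int_hyperplane[OF M(1)] using M LH L dM \<open>L \<noteq> {}\<close> by auto
    qed (use L M LH \<open>L \<noteq> {}\<close> in auto)
    then have "inv_at (c, 0) ` hemi M a (dist c a) = X"
      unfolding L(3) inv_at_image_hemi[OF M(1,2) refl] by simp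
    then have "inv_at (c, 0) ` X = hemi M a (dist c a)" using image_inv_at_inv_at by blast
    moreover have "a \<in> M"
      using affine_scale_from[OF M(1,2), of "1 / (2 * (g \<bullet> g))" y] M(3) y(1) \<open>g \<noteq> 0\<close>
      by (auto simp: a_def g_def)
    moreover have "dist c a > 0" using \<open>g \<noteq> 0\<close> by (simp add: a_def)
    ultimately show ?thesis using hplane_hemi[OF M(1) dM] by simp
  qed
qed

text \<open>The derivative of \<open>inv_at a\<close> at \<open>a + z\<close> in direction
  \<open>u\<close>: for nonzero \<open>z\<close>, the reflection in the hyperplane orthogonal to
  \<open>z\<close>, divided by the square of \<open>norm z\<close>.\<close>

definition inv_at_deriv :: "'a::real_inner \<Rightarrow> 'a \<Rightarrow> 'a" where
  "inv_at_deriv z u = (1 / (norm z)\<^sup>2) *\<^sub>R u - (2 * (z \<bullet> u) / (norm z)^4) *\<^sub>R z"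

lemma norm_power4: "(norm z)^4 = (z \<bullet> z)\<^sup>2"
  by (simp flip: power2_norm_eq_inner)

text \<open>Reflections preserve inner products, so only the square of the scaling factor remains:
  inversion is conformal.\<close>

lemma inner_inv_at_deriv:
  assumes "z \<noteq> 0"
  shows "inv_at_deriv z u \<bullet> inv_at_deriv z w = (u \<bullet> w) / (norm z)^4"
proof -
  define N where "N = z \<bullet> z"
  have N: "N \<noteq> 0" "(norm z)\<^sup>2 = N" "(norm z)^4 = N\<^sup>2" "z \<bullet> z = N"
    using assms by (simp_all add: N_def norm_power4 power2_norm_eq_inner)
  show ?thesis
    unfolding inv_at_deriv_def N
    using N(1) by (simp add: inner_diff_left inner_diff_right N inner_commute field_simps power2_eq_square)
qed

text \<open>The first argument is the image point relative to the centre, so this is the chain rule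
  for an inversion composed with itself.\<close>

lemma inv_at_deriv_inverse:
  assumes "z \<noteq> 0"
  shows "inv_at_deriv ((1 / (norm z)\<^sup>2) *\<^sub>R z) (inv_at_deriv z u) = u"
proof -
  define N where "N = z \<bullet> z"
  have N: "N \<noteq> 0" "(norm z)\<^sup>2 = N" "(norm z)^4 = N\<^sup>2" "z \<bullet> z = N"
    using assms by (simp_all add: N_def norm_power4 power2_norm_eq_inner)
  define z' where "z' = (1 / N) *\<^sub>R z"
  have z': "(norm z')\<^sup>2 = 1 / N" "(norm z')^4 = 1 / N\<^sup>2"
    unfolding norm_power4 power2_norm_eq_inner
    using N(1) by (simp_all add: z'_def N(4) power2_eq_square)
  have "z' \<bullet> inv_at_deriv z u = - (z \<bullet> u) / N\<^sup>2"
    using N by (simp add: z'_def inv_at_deriv_def inner_diff_right power2_eq_square field_simps)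
  then have "inv_at_deriv z' (inv_at_deriv z u) = N *\<^sub>R inv_at_deriv z u + (2 * (z \<bullet> u) / N) *\<^sub>R z"
    using N by (simp add: inv_at_deriv_def[of z'] z') (simp add: z'_def)
  also have "\<dots> = u"
    using N by (simp add: inv_at_deriv_def power2_eq_square scaleR_diff_right)
  finally show ?thesis by (simp add: z'_def N)
qed

lemma has_vector_derivative_inv_at:
  assumes c: "(c has_vector_derivative u) (at x)" and ne: "c x \<noteq> a"
  shows "((\<lambda>s. inv_at a (c s)) has_vector_derivative inv_at_deriv (c x - a) u) (at x)"
proof -
  have d: "((\<lambda>s. c s - a) has_vector_derivative u) (at x)"
    using has_vector_derivative_diff[OF c has_vector_derivative_const[of a]] by simp
  have "((\<lambda>s. (c s - a) \<bullet> (c s - a)) has_vector_derivative (c x - a) \<bullet> u + u \<bullet> (c x - a)) (at x)"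
    by (rule bounded_bilinear.has_vector_derivative[OF bounded_bilinear_inner d d])
  then have "((\<lambda>s. (c s - a) \<bullet> (c s - a)) has_real_derivative 2 * ((c x - a) \<bullet> u)) (at x)"
    by (simp add: has_real_derivative_iff_has_vector_derivative inner_commute)
  then have "((\<lambda>s. 1 / ((c s - a) \<bullet> (c s - a))) has_real_derivative
      - (2 * ((c x - a) \<bullet> u)) / ((c x - a) \<bullet> (c x - a))\<^sup>2) (at x)"
    by (auto intro!: derivative_eq_intros simp: ne power2_eq_square)
  then have "((\<lambda>s. a + (1 / ((c s - a) \<bullet> (c s - a))) *\<^sub>R (c s - a)) has_vector_derivative
      0 + ((1 / ((c x - a) \<bullet> (c x - a))) *\<^sub>R u
        + (- (2 * ((c x - a) \<bullet> u)) / ((c x - a) \<bullet> (c x - a))\<^sup>2) *\<^sub>R (c x - a))) (at x)"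
    by (intro has_vector_derivative_add has_vector_derivative_const has_vector_derivative_scaleR d)
  then show ?thesis
    by (simp add: inv_at_def inv_at_deriv_def norm_power4 power2_norm_eq_inner)
qed

lemma tangent_space_inv_at:
  assumes u: "u \<in> tangent_space X p" and ne: "p \<noteq> a"
  shows "inv_at_deriv (p - a) u \<in> tangent_space (inv_at a ` X) (inv_at a p)"
proof -
  obtain c where c: "c 0 = p" "eventually (\<lambda>s. c s \<in> X) (nhds 0)" "(c has_vector_derivative u) (at 0)"
    using u unfolding tangent_space_def by blast
  have "eventually (\<lambda>s. inv_at a (c s) \<in> inv_at a ` X) (nhds 0)"
    using c(2) by eventually_elim blast
  moreover have "((\<lambda>s. inv_at a (c s)) has_vector_derivative inv_at_deriv (p - a) u) (at 0)"
    using has_vector_derivative_inv_at[OF c(3), of a] c(1) ne by simp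
  ultimately show ?thesis
    unfolding tangent_space_def using c(1) by (intro CollectI exI[of _ "\<lambda>s. inv_at a (c s)"]) simp
qed

text \<open>The conformal factor of the inner product cancels against the squared change of height,
  so inversion is a hyperbolic isometry.\<close>

lemma hyp_metric_inv_at:
  assumes "p \<noteq> (a, 0)"
  shows "hyp_metric (inv_at (a, 0) p) (inv_at_deriv (p - (a, 0)) u) (inv_at_deriv (p - (a, 0)) w)
    = hyp_metric p u w"
proof -
  define z where "z = p - (a, 0)"
  have z: "z \<noteq> 0" using assms by (simp add: z_def)
  have "(u \<bullet> w) / (norm z)^4 / (snd p / (norm z)\<^sup>2)\<^sup>2 = (u \<bullet> w) / (snd p)\<^sup>2"
    using z by (simp add: power_divide flip: power_mult)
  then show ?thesis
    unfolding hyp_metric_def snd_inv_at z_def[symmetric] inner_inv_at_deriv[OF z] .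
qed

text \<open>Tangent vectors at an image point are carried back by the derivative of the inversion
  there, and the hypothesis is applied at the original point.\<close>

lemma orth_along_inv_at:
  assumes l: "l \<subseteq> H4" and orth: "orth_along P Q l"
  shows "orth_along (inv_at (c, 0) ` P) (inv_at (c, 0) ` Q) (inv_at (c, 0) ` l)"
  unfolding orth_along_def
proof (intro ballI impI)
  let ?J = "inv_at (c, 0::real)" let ?D = "\<lambda>p. inv_at_deriv (p - (c, 0))"
  fix p' u' w'
  assume p': "p' \<in> ?J ` l" and u': "u' \<in> tangent_space (?J ` P) p'" and w': "w' \<in> tangent_space (?J ` Q) p'"
    and o: "(\<forall>d\<in>tangent_space (?J ` l) p'. hyp_metric p' u' d = 0) \<and>
      (\<forall>d\<in>tangent_space (?J ` l) p'. hyp_metric p' w' d = 0)"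
  obtain p where p: "p \<in> l" "p' = ?J p" using p' by blast
  have ne: "p \<noteq> (c, 0)" using p(1) l H4_not_boundary by blast
  then have ne': "p' \<noteq> (c, 0)" by (simp add: p(2))
  have pp: "?J p' = p" by (simp add: p(2))
  have DD: "?D p (?D p' x) = x" for x
    using inv_at_deriv_inverse[of "p' - (c, 0)" x] ne' inv_at_diff[of "(c, 0)" p'] by (simp add: pp)
  \<comment> \<open>The derivative can be moved from one argument of the metric to the other, so
    normality to the image of \<open>l\<close> becomes normality to \<open>l\<close>.\<close>
  have g: "hyp_metric p (?D p' x) d = hyp_metric p' x (?D p d)" for x d
    using hyp_metric_inv_at[OF ne, of "?D p' x" d] by (simp add: DD p(2)[symmetric])
  have u: "?D p' u' \<in> tangent_space P p" and w: "?D p' w' \<in> tangent_space Q p"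
    using tangent_space_inv_at[OF u' ne'] tangent_space_inv_at[OF w' ne'] by (simp_all add: pp)
  have "?D p d \<in> tangent_space (?J ` l) p'" if "d \<in> tangent_space l p" for d
    using tangent_space_inv_at[OF that ne] by (simp add: p(2))
  then have "\<forall>d\<in>tangent_space l p. hyp_metric p (?D p' u') d = 0"
    and "\<forall>d\<in>tangent_space l p. hyp_metric p (?D p' w') d = 0"
    using o unfolding g by blast+
  then have "hyp_metric p (?D p' u') (?D p' w') = 0"
    using orth p(1) u w unfolding orth_along_def by blast
  then show "hyp_metric p' u' w' = 0" using hyp_metric_inv_at[OF ne'] by (simp add: pp)
qed

text \<open>The common line has the centre as an ideal point, so its image is again a line, now
  ending at infinity; intersections and orthogonality are carried along.\<close>

lemma orth_through_line_at_center_imp: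
  assumes "orth_through_line_at P Q (Some (c, 0))"
  shows "orth_through_line_at (inv_at (c, 0) ` P) (inv_at (c, 0) ` Q) None"
proof -
  obtain l where l: "hplane 1 l" "P \<inter> Q = l" "Some (c, 0) \<in> ideal_bd l" "orth_along P Q l"
    using assms unfolding orth_through_line_at_def by blast
  have "l \<subseteq> H4" using hplane_subset_H4 l(1) .
  moreover have "None \<in> sph_inv c 1 ` ideal_bd l" by (rule rev_image_eqI[OF l(3)]) (simp add: sph_inv_one)
  moreover have "inv_at (c, 0) ` P \<inter> inv_at (c, 0) ` Q = inv_at (c, 0) ` l"
    by (simp add: image_Int[OF inj_inv_at] flip: l(2))
  moreover have "(c, 0) \<in> closure l" using l(3) by simp
  ultimately show ?thesis
    unfolding orth_through_line_at_def using hplane_inv_at[OF l(1)] orth_along_inv_at l(4)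
    by (metis ideal_bd_inv_at)
qed

lemma orth_through_line_at_infinity_imp:
  assumes "orth_through_line_at P Q None"
  shows "orth_through_line_at (inv_at (c, 0) ` P) (inv_at (c, 0) ` Q) (Some (c, 0))"
proof -
  obtain l where l: "hplane 1 l" "P \<inter> Q = l" "None \<in> ideal_bd l" "orth_along P Q l"
    using assms unfolding orth_through_line_at_def by blast
  have "l \<subseteq> H4" using hplane_subset_H4 l(1) .
  moreover have "Some (c, 0) \<in> sph_inv c 1 ` ideal_bd l" by (rule rev_image_eqI[OF l(3)]) (simp add: sph_inv_one)
  moreover have "inv_at (c, 0) ` P \<inter> inv_at (c, 0) ` Q = inv_at (c, 0) ` l"
    by (simp add: image_Int[OF inj_inv_at] flip: l(2))
  moreover have "\<not> bounded l" using l(3) by simp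
  ultimately show ?thesis
    unfolding orth_through_line_at_def using hplane_inv_at_unbounded[OF l(1)] orth_along_inv_at l(4)
    by (metis ideal_bd_inv_at)
qed

section \<open>Equivalence at infinity and its transfer to a finite fixed point\<close>

lemma pencils_iff_orth_at_infinity:
  assumes "e \<noteq> 0" "hplane 2 Q"
  shows "orth_through_line_at (vert (line_through q e)) Q None \<longleftrightarrow>
    (\<exists>k S. hplane 3 S \<and> vert (line_through q e) \<subseteq> S \<and> ideal_bd Q = bd_plane e k \<inter> ideal_bd S)"
  using orth_through_line_at_infinity_imp_pencils[OF assms]
    pencils_imp_orth_through_line_at_infinity[OF assms] by blast

text \<open>Either side makes the centre an ideal point of \<open>Q\<close>, so \<open>Q\<close>
  inverts to a vertical plane and the equivalence at infinity applies. Inversion then carries the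
  hyperplane \<open>S\<close> and the boundary equation across.\<close>

lemma pencils_iff_orth_at_center:
  assumes e: "e \<noteq> 0" and Q: "hplane 2 Q"
  shows "orth_through_line_at (inv_at (c, 0) ` vert (line_through q e)) Q (Some (c, 0)) \<longleftrightarrow>
    (\<exists>k S. hplane 3 S \<and> inv_at (c, 0) ` vert (line_through q e) \<subseteq> S \<and>
      ideal_bd Q = sph_inv c 1 ` bd_plane e k \<inter> ideal_bd S)"
    (is "?L \<longleftrightarrow> ?R")
proof
  let ?J = "inv_at (c, 0::real)" let ?i = "sph_inv c 1" let ?P = "vert (line_through q e)"
  note QH = hplane_subset_H4[OF Q]
  have Punb: "\<not> bounded ?P" by (simp add: bounded_vert_iff)
  have Jsub: "?P \<subseteq> ?J ` S \<longleftrightarrow> ?J ` ?P \<subseteq> S" for S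
    using image_mono[of ?P "?J ` S" ?J] image_mono[of "?J ` ?P" S ?J] by auto
  have ii: "?i ` (X \<inter> Y) = ?i ` X \<inter> ?i ` Y" for X Y
    by (rule image_Int[OF inj_sph_inv]) simp
  { assume ?L
    then have "orth_through_line_at ?P (?J ` Q) None"
      using orth_through_line_at_center_imp by fastforce
    \<comment> \<open>The common line lies in \<open>Q\<close> and ends at the centre.\<close>
    moreover have "Some (c, 0) \<in> ideal_bd Q"
      using \<open>?L\<close> ideal_bd_mono unfolding orth_through_line_at_def by blast
    then have JQ: "hplane 2 (?J ` Q)" using hplane_inv_at[OF Q] by simp
    ultimately obtain k S where S: "hplane 3 S" "?P \<subseteq> S" "ideal_bd (?J ` Q) = bd_plane e k \<inter> ideal_bd S"
      unfolding pencils_iff_orth_at_infinity[OF e JQ] by (elim exE conjE) (rule that; assumption)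
    \<comment> \<open>\<open>S\<close> contains the unbounded set \<open>?P\<close>, so it is
      vertical and its image is a hyperplane.\<close>
    have "hplane 3 (?J ` S)"
      using hplane_inv_at_unbounded[OF S(1)] Punb S(2) bounded_subset by blast
    moreover have "?i ` ideal_bd (?J ` Q) = ideal_bd Q"
      by (simp add: ideal_bd_inv_at[OF QH] image_sph_inv_sph_inv)
    then have "ideal_bd Q = ?i ` bd_plane e k \<inter> ideal_bd (?J ` S)"
      unfolding S(3) ii ideal_bd_inv_at[OF hplane_subset_H4[OF S(1)]] by simp
    ultimately show ?R using S(2) by (metis image_mono) }
  { assume ?R
    then obtain k S where S: "hplane 3 S" "?J ` ?P \<subseteq> S" "ideal_bd Q = ?i ` bd_plane e k \<inter> ideal_bd S"
      by blast
    note SH = hplane_subset_H4[OF S(1)]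
    have "?P \<subseteq> ?J ` S" using S(2) Jsub by blast
    \<comment> \<open>Infinity being an ideal point of the inverted \<open>S\<close>, the centre is
      one of \<open>S\<close>. It also lies on the inverted \<open>bd_plane e k\<close>, as the
      image of \<open>None\<close>, hence on the boundary of \<open>Q\<close>.\<close>
    then have "None \<in> ideal_bd (?J ` S)" using Punb bounded_subset by auto
    then have "?i None \<in> ?i ` ?i ` ideal_bd S" unfolding ideal_bd_inv_at[OF SH] by blast
    then have cS: "Some (c, 0) \<in> ideal_bd S" by (simp add: image_sph_inv_sph_inv sph_inv_one)
    moreover have "?i None \<in> ?i ` bd_plane e k" by blast
    ultimately have "Some (c, 0) \<in> ideal_bd Q" unfolding S(3) by (simp add: sph_inv_one)
    then have JQ: "hplane 2 (?J ` Q)" using hplane_inv_at[OF Q] by simp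
    have "hplane 3 (?J ` S)" using hplane_inv_at[OF S(1)] cS by simp
    moreover have "ideal_bd (?J ` Q) = bd_plane e k \<inter> ideal_bd (?J ` S)"
      unfolding ideal_bd_inv_at[OF QH] S(3) ii ideal_bd_inv_at[OF SH]
      by (subst image_sph_inv_sph_inv) simp_all
    ultimately have "orth_through_line_at ?P (?J ` Q) None"
      using pencils_iff_orth_at_infinity[OF e JQ] Jsub S(2) by blast
    from orth_through_line_at_infinity_imp[OF this, of c] show ?L by simp }
qed

section \<open>Normalizing the screw parabolic isometry\<close>

text \<open>\<open>f\<close> acts horizontally by a similarity \<open>m\<close>, which pulls the
  axis of the rotation back to a line with direction \<open>e\<close> and planes orthogonal to
  \<open>b\<close> back to planes orthogonal to \<open>e\<close>.\<close>

lemma normalized_pencil_data: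
  assumes f: "mobius f" "f None = None"
    and A: "orthogonal_matrix A" "det A = 1" "A \<noteq> mat 1" "A *v b = b" "b \<noteq> 0"
  obtains q e where "e \<noteq> 0"
    "\<And>p. p \<in> H4 \<Longrightarrow> affext A 0 (f (Some p)) = f (Some p) \<longleftrightarrow> p \<in> vert (line_through q e)"
    "{f -` bd_plane b k | k. True} = {bd_plane e k | k. True}"
proof -
  obtain k m where k: "k > 0" and d: "\<And>x y. dist (m x) (m y) = k * dist x y"
    and m: "\<And>x t. f (Some (x,t)) = Some (m x, k * t)"
    by (rule mobius_fixing_None[OF f]) (rule that; assumption)
  \<comment> \<open>The similarity stripped of scaling and translation: an isometry fixing 0, hence
    linear and orthogonal.\<close>
  define g where "g x = (1 / k) *\<^sub>R (m x - m 0)" for x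
  have "orthogonal_transformation g"
    unfolding orthogonal_transformation_isometry
    using k d by (auto simp: g_def dist_norm simp flip: scaleR_diff_right)
  then have inner: "g x \<bullet> g y = x \<bullet> y" and lin: "linear g" and bij: "bij g" for x y
    by (auto simp: orthogonal_transformation_def orthogonal_transformation_bij)
  have mg: "m x = k *\<^sub>R g x + m 0" for x using k by (simp add: g_def)
  obtain e where e: "g e = b" using bij by (metis bij_pointE)
  \<comment> \<open>Chosen so that \<open>m q = 0\<close>, which puts \<open>q\<close> on the
    preimage of the axis.\<close>
  obtain q where q: "g q = - (1 / k) *\<^sub>R m 0" using bij by (metis bij_pointE)
  have "e \<noteq> 0" using e A(5) linear_0[OF lin] by auto
  moreover have "affext A 0 (f (Some p)) = f (Some p) \<longleftrightarrow> p \<in> vert (line_through q e)" if "p \<in> H4" for p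
  proof -
    obtain x t where p: "p = (x, t)" by fastforce
    have "affext A 0 (f (Some p)) = f (Some p) \<longleftrightarrow> (\<exists>s. m x = s *\<^sub>R b)"
      using rotation_fixed_line[OF A, of "m x"] by (simp add: p m affext_def)
    also have "\<dots> \<longleftrightarrow> (\<exists>s. x = q + s *\<^sub>R e)"
    proof
      assume "\<exists>s. m x = s *\<^sub>R b"
      then obtain s where s: "m x = s *\<^sub>R b" by blast
      have "g (q + (s / k) *\<^sub>R e) = (1 / k) *\<^sub>R (m x - m 0)"
        by (simp add: linear_add[OF lin] linear_scale[OF lin] e q s algebra_simps)
      then have "g (q + (s / k) *\<^sub>R e) = g x" by (simp add: g_def)
      then show "\<exists>s. x = q + s *\<^sub>R e" using bij by (metis bij_def injD)
    next
      assume "\<exists>s. x = q + s *\<^sub>R e"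
      then obtain s where s: "x = q + s *\<^sub>R e" by blast
      have "m x = (k * s) *\<^sub>R b"
        using k unfolding mg[of x]
        by (simp add: s linear_add[OF lin] linear_scale[OF lin] e q algebra_simps)
      then show "\<exists>s. m x = s *\<^sub>R b" by blast
    qed
    also have "\<dots> \<longleftrightarrow> p \<in> vert (line_through q e)" using that by (auto simp: p vert_def H4_def)
    finally show ?thesis .
  qed
  moreover have "{f -` bd_plane b k' | k'. True} = {bd_plane e k' | k'. True}"
  proof -
    have mb: "m x \<bullet> b = k * (x \<bullet> e) + m 0 \<bullet> b" for x
      using inner[of x e] by (simp add: mg[of x] e inner_add_left)
    have *: "f -` bd_plane b k' = bd_plane e ((k' - m 0 \<bullet> b) / k)" for k'
    proof (rule set_eqI)
      fix v show "v \<in> f -` bd_plane b k' \<longleftrightarrow> v \<in> bd_plane e ((k' - m 0 \<bullet> b) / k)"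
      proof (cases v)
        case (Some p)
        obtain x t where p: "p = (x, t)" by fastforce
        have "m x \<bullet> b = k' \<longleftrightarrow> x \<bullet> e = (k' - m 0 \<bullet> b) / k"
          unfolding mb[of x] using k by (auto simp: field_simps)
        then show ?thesis using k by (auto simp: Some p m)
      qed (simp add: f(2))
    qed
    \<comment> \<open>The change of level is an invertible affine function of \<open>k'\<close>, so
      every plane orthogonal to \<open>e\<close> occurs.\<close>
    have **: "bd_plane e k' = f -` bd_plane b (k * k' + m 0 \<bullet> b)" for k'
      unfolding * using k by simp
    show ?thesis
    proof (intro equalityI subsetI; elim CollectE exE conjE)
      fix X k' assume "X = f -` bd_plane b k'"
      then show "X \<in> {bd_plane e k' | k'. True}" unfolding * by (intro CollectI exI conjI TrueI)
    next
      fix X k' assume "X = bd_plane e k'"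
      then show "X \<in> {f -` bd_plane b k' | k'. True}" unfolding ** by (intro CollectI exI conjI TrueI)
    qed
  qed
  ultimately show ?thesis by (rule that)
qed

lemma twisting_plane_eq:
  assumes "bij \<phi>"
  shows "twisting_plane \<phi> A = {p \<in> H4. affext A 0 (\<phi> (Some p)) = \<phi> (Some p)}"
  using assms unfolding twisting_plane_def
  by (metis (no_types, lifting) bij_inv_eq_iff comp_apply)

lemma permuted_pencil_eq:
  assumes "bij \<phi>"
  shows "permuted_pencil \<phi> b = {\<phi> -` bd_plane b k | k. True}"
  using bij_vimage_eq_inv_image[OF assms] by (simp add: permuted_pencil_def)

theorem theorem5p10:
  fixes \<gamma> \<phi> :: "pt \<Rightarrow> pt" and A :: "real^3^3" and b :: "real^3" and v :: pt
    and Q :: "((real^3) \<times> real) set"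
  assumes "mobius \<phi>"
    and "orthogonal_matrix A" and "det A = 1" and "A \<noteq> mat 1"
    and "A *v b = b" and "b \<noteq> 0"
    and "\<phi> v = None"
    and "\<gamma> = inv \<phi> \<circ> affext A b \<circ> \<phi>"
    and "hplane 2 Q"
  shows "orth_through_line_at (twisting_plane \<phi> A) Q v
           \<longleftrightarrow> ideal_bd Q \<in> half_turn_bank \<phi> A b"
proof -
  note bij = mobius_bij[OF assms(1)]
  consider (inf) "v = None" | (fin) c where "v = Some (c, 0)"
    using mobius_to_None[OF assms(1,7)] by blast
  then show ?thesis
  proof cases
    case inf
    obtain q e where e: "e \<noteq> 0"
      and P: "\<And>p. p \<in> H4 \<Longrightarrow> affext A 0 (\<phi> (Some p)) = \<phi> (Some p) \<longleftrightarrow> p \<in> vert (line_through q e)"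
      and F: "{\<phi> -` bd_plane b k | k. True} = {bd_plane e k | k. True}"
      by (rule normalized_pencil_data[OF assms(1) assms(7)[unfolded inf] assms(2-6)]) (rule that; assumption)
    have P: "twisting_plane \<phi> A = vert (line_through q e)"
      unfolding twisting_plane_eq[OF bij] using P vert_subset_H4 by blast
    show ?thesis
      unfolding inf half_turn_bank_def permuted_pencil_eq[OF bij] F P twisting_pencil_def
        pencils_iff_orth_at_infinity[OF e assms(9)] by blast
  next
    case fin
    \<comment> \<open>The inversion sends infinity to \<open>v\<close>, which \<open>\<phi>\<close>
      sends back to infinity, so \<open>f\<close> fixes \<open>None\<close>.\<close>
    define f where "f = \<phi> \<circ> sph_inv c 1"
    have f: "mobius f" "f None = None"
      using mobius_comp_sph_inv[OF assms(1)] assms(7) fin by (simp_all add: f_def sph_inv_one)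
    have \<phi>: "\<phi> w = f (sph_inv c 1 w)" for w by (simp add: f_def sph_inv_sph_inv)
    obtain q e where e: "e \<noteq> 0"
      and P: "\<And>p. p \<in> H4 \<Longrightarrow> affext A 0 (f (Some p)) = f (Some p) \<longleftrightarrow> p \<in> vert (line_through q e)"
      and F: "{f -` bd_plane b k | k. True} = {bd_plane e k | k. True}"
      by (rule normalized_pencil_data[OF f assms(2-6)]) (rule that; assumption)
    have "affext A 0 (\<phi> (Some p)) = \<phi> (Some p) \<longleftrightarrow> inv_at (c, 0) p \<in> vert (line_through q e)"
      if "p \<in> H4" for p
      using P[OF inv_at_H4[OF that, of c]] sph_inv_one(3)[OF H4_not_boundary[OF that]] by (simp add: \<phi>)
    \<comment> \<open>The condition \<open>p \<in> H4\<close> in the twisting plane follows from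
      membership of the inverted point in a vertical set.\<close>
    moreover have "p \<in> H4" if "inv_at (c, 0) p \<in> vert L" for p L
      using inv_at_H4[of "inv_at (c, 0) p" c] that vert_subset_H4 by auto
    ultimately have P: "twisting_plane \<phi> A = inv_at (c, 0) ` vert (line_through q e)"
      unfolding twisting_plane_eq[OF bij] inv_at_image_eq by blast
    have "\<phi> -` X = sph_inv c 1 ` (f -` X)" for X
    proof -
      have "\<phi> -` X = sph_inv c 1 -` (f -` X)" by (auto simp: \<phi>)
      then show ?thesis by (simp add: vimage_sph_inv)
    qed
    then have "permuted_pencil \<phi> b = (\<lambda>X. sph_inv c 1 ` X) ` {f -` bd_plane b k | k. True}"
      unfolding permuted_pencil_eq[OF bij] by (simp only: image_Collect) blast
    then have F: "permuted_pencil \<phi> b = {sph_inv c 1 ` bd_plane e k | k. True}"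
      unfolding F by (simp only: image_Collect) blast
    show ?thesis
      unfolding fin half_turn_bank_def F P twisting_pencil_def
        pencils_iff_orth_at_center[OF e assms(9)] by blast
  qed
qed

end
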